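(* Let $J:=\operatorname{conv}\{\mathbf{v}_0,\mathbf{v}_1,\dots,\mathbf{v}_d\}\subset\mathbb{R}^d_{\ge 0}\setminus\{\mathbf{0}\}$ be a $d$-simplex, and suppose $f(\mathbf{0})=0$ and $f$ is continuous and convex on $\operatorname{conv}(J\cup\{\mathbf{0}\})$. Then $$\operatorname{vol}(P^0(f,J))=\frac{1}{(d+2)!}\left|\det\begin{bmatrix}\mathbf{v}_0&\mathbf{v}_1&\dots&\mathbf{v}_d\\ 1&1&\dots&1\end{bmatrix}\right|\sum_{j=0}^d f(\mathbf{v}_j)-\int_0^1 z^d\int_J f(z\mathbf{x})\,d\mathbf{x}\,dz.$$
   Context: Let $\mu:\mathbb{R}^d\to\mathbb{R}$ be the unique affine function agreeing with $f$ at the vertices of $J$, and let $\mu(\mathbf{x},z):=z\,\mu(\mathbf{x}/z)$ (which extends to a linear function of $(\mathbf{x},z)$, e.g. $\mu(\mathbf{x},z)=\mathbf{w}^\top\mathbf{B}^{-1}(\mathbf{x}-z\mathbf{v}_0)+f(\mathbf{v}_0)z$ with $\mathbf{B}=[\mathbf{v}_1-\mathbf{v}_0,\dots,\mathbf{v}_d-\mathbf{v}_0]$, $\mathbf{w}_j=f(\mathbf{v}_j)-f(\mathbf{v}_0)$). For $z\ge0$, $z\cdot J:=\{z\mathbf{x}:\mathbf{x}\in J\}$. The naive relaxation is $$P^0(f,J):=\{(\mathbf{x},y,z)\in\mathbb{R}^d\times\mathbb{R}\times\mathbb{R}:\ \mu(\mathbf{x},z)\ge y\ge f(\mathbf{x}),\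 \mathbf{x}\in z\cdot J,\ 1\ge z\ge 0\}.$$ $\operatorname{vol}$ denotes $(d+2)$-dimensional Lebesgue measure. *)

theory Defs
  imports "HOL-Analysis.Analysis"
begin

(* Vertices of the simplex are indexed by 'n option: v None = v_0, v (Some j) = v_j, j = 1..d,
   where d = CARD('n). *)

definition simplex_J :: "('n::finite option \<Rightarrow> real^'n) \<Rightarrow> (real^'n) set" where
  "simplex_J v = convex hull (range v)"

definition edge_mat :: "('n::finite option \<Rightarrow> real^'n) \<Rightarrow> real^'n^'n" where
  "edge_mat v = (\<chi> i j. (v (Some j) - v None) $ i)"

definition wvec :: "(real^'n \<Rightarrow> real) \<Rightarrow> ('n::finite option \<Rightarrow> real^'n) \<Rightarrow> real^'n" where
  "wvec f v = (\<chi> j. f (v (Some j)) - f (v None))"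

definition mu_hom :: "(real^'n \<Rightarrow> real) \<Rightarrow> ('n::finite option \<Rightarrow> real^'n) \<Rightarrow> real^'n \<Rightarrow> real \<Rightarrow> real" where
  "mu_hom f v x z = wvec f v \<bullet> (matrix_inv (edge_mat v) *v (x - z *\<^sub>R v None)) + f (v None) * z"

definition scaled_set :: "real \<Rightarrow> (real^'n) set \<Rightarrow> (real^'n) set" where
  "scaled_set z S = (\<lambda>x. z *\<^sub>R x) ` S"

definition P0 :: "(real^'n \<Rightarrow> real) \<Rightarrow> ('n::finite option \<Rightarrow> real^'n) \<Rightarrow> (((real^'n) \<times> real) \<times> real) set" where
  "P0 f v = {((x, y), z). mu_hom f v x z \<ge> y \<and> y \<ge> f x \<and> x \<in> scaled_set z (simplex_J v)
                          \<and> 1 \<ge> z \<and> z \<ge> 0}"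

definition vert_mat :: "('n::finite option \<Rightarrow> real^'n) \<Rightarrow> real^('n option)^('n option)" where
  "vert_mat v = (\<chi> i j. (case i of None \<Rightarrow> 1 | Some k \<Rightarrow> v j $ k))"

end

theory Submission
  imports Defs
begin

text \<open>
  Convexity and \<open>f 0 = 0\<close> give \<open>f (z u) \<le> z \<mu>(u)\<close> for \<open>u \<in> J\<close> and \<open>z \<in> [0, 1]\<close>. So the slice of \<open>P0\<close> at
  height \<open>z\<close> is the region between two graphs over \<open>z J\<close>, and after the substitution \<open>x = z u\<close> its
  volume is \<open>z^(d+1) \<integral>\<^sub>J \<mu> - z^d \<integral>\<^sub>J f (z u) du\<close>. It remains to see that
  \<open>\<integral>\<^sub>J \<mu> = vol J / (d+1) * \<Sum>\<^sub>j f (v\<^sub>j)\<close>. As \<open>\<mu>\<close> is a combination of the barycentric coordinates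
  \<open>\<lambda>\<^sub>j\<close>, it is enough that \<open>\<integral>\<^sub>J \<lambda>\<^sub>j = vol J / (d+1)\<close>; this is a layer-cake computation, since
  \<open>{\<lambda>\<^sub>j \<ge> t}\<close> is the homothetic copy \<open>t v\<^sub>j + (1 - t) J\<close> of \<open>J\<close>.
\<close>

section \<open>Lebesgue measure under linear maps\<close>

lemma measure_shear_cbox:
  fixes a b :: "real^'n"
  assumes "m \<noteq> n"
  defines "h \<equiv> \<lambda>x::real^'n. \<chi> i. if i = m then x$m + x$n else x$i"
  shows "measure lebesgue (h ` cbox a b) = measure lebesgue (cbox a b)"
proof (cases "cbox a b = {}")
  case False
  \<comment> \<open>\<open>measure_shear_interval\<close> asks for a nonnegative lower bound in
    coordinate \<open>n\<close>; translating by \<open>c\<close> makes that bound zero.\<close>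
  define c :: "real^'n" where "c = axis n (a$n)"
  have add: "h (x + y) = h x + h y" for x y
    by (simp add: h_def vec_eq_iff)
  have box: "cbox a b = (+) c ` cbox (a - c) (b - c)"
    by (simp add: cbox_translation[symmetric])
  have "h ` cbox a b = (+) (h c) ` h ` cbox (a - c) (b - c)"
    unfolding box by (simp add: image_image add)
  then have "measure lebesgue (h ` cbox a b) = measure lebesgue (h ` cbox (a - c) (b - c))"
    by (simp add: measure_translation)
  also have "\<dots> = measure lebesgue (cbox (a - c) (b - c))"
    unfolding h_def using assms(1) False box
    by (intro measure_shear_interval) (auto simp: c_def)
  also have "\<dots> = measure lebesgue (cbox a b)"
    unfolding box by (simp only: measure_translation)
  finally show ?thesis .
qed simp

text \<open>The swap is an involution, so it carries a box onto the box with swapped bounds, and the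
  product of the side lengths is merely reindexed.\<close>

lemma measure_transpose_cbox:
  fixes a b :: "real^'n" and m n :: 'n
  defines "h \<equiv> \<lambda>x::real^'n. \<chi> i. x $ Transposition.transpose m n i"
  shows "measure lebesgue (h ` cbox a b) = measure lebesgue (cbox a b)"
proof (cases "cbox a b = {}")
  case False
  let ?t = "Transposition.transpose m n"
  have hh: "h (h x) = x" for x
    by (simp add: h_def vec_eq_iff)
  have all: "(\<forall>i. P (?t i)) \<longleftrightarrow> (\<forall>i. P i)" for P
    by (metis transpose_involutory)
  have mem: "h x \<in> cbox (h a) (h b) \<longleftrightarrow> x \<in> cbox a b" for x
    using all[of "\<lambda>i. a$i \<le> x$i \<and> x$i \<le> b$i"] by (simp add: mem_box_cart h_def)
  have "h ` cbox a b = cbox (h a) (h b)"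
  proof (intro equalityI subsetI)
    fix y assume "y \<in> cbox (h a) (h b)"
    then have "h y \<in> cbox a b"
      using mem[of "h y"] by (simp add: hh)
    then show "y \<in> h ` cbox a b"
      by (rule image_eqI[rotated]) (simp add: hh)
  qed (use mem in auto)
  moreover from this have "cbox (h a) (h b) \<noteq> {}"
    using False by auto
  moreover have "(\<Prod>i\<in>UNIV. b $ ?t i - a $ ?t i) = (\<Prod>i\<in>UNIV. b$i - a$i)"
    using prod.reindex_bij_betw[of ?t UNIV UNIV "\<lambda>i. b$i - a$i"] by simp
  ultimately show ?thesis
    using False by (simp add: content_cbox_cart) (simp add: h_def)
qed simp

text \<open>The library proves this for well-ordered index types only.\<close>

lemma measure_linear_image_finite:
  fixes f :: "real^'n \<Rightarrow> real^'n"
  assumes "linear f" and "S \<in> lmeasurable"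
  shows "f ` S \<in> lmeasurable \<and> measure lebesgue (f ` S) = \<bar>det (matrix f)\<bar> * measure lebesgue S"
  using assms(2)
proof (induction arbitrary: S rule: induct_linear_elementary [OF assms(1)])
  case (1 f g)
  have "(f \<circ> g) ` S = f ` (g ` S)"
    by (rule image_comp[symmetric])
  then show ?case
    using 1(3)[OF conjunct1[OF 1(4)[OF 1(5)]]] 1(4)[OF 1(5)] matrix_compose[OF 1(2,1)]
    by (simp add: abs_mult det_mul o_def)
next
  case (2 f i)
  \<comment> \<open>Coordinate \<open>i\<close> of every value is zero, so no value has 1 there.
    Hence the image is negligible and the determinant zero.\<close>
  have "\<not> surj f"
    using 2(2) by (metis surjD one_neq_zero vec_component)
  then have "\<not> inj f"
    using 2(1) linear_injective_imp_surjective by blast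
  then show ?case
    using 2(1) negligible_linear_singular_image[of f S] det_nz_iff_inj[of f]
    by (auto simp: negligible_iff_measure)
next
  case (3 c)
  then show ?case
    by (simp add: measurable_stretch measure_stretch matrix_def axis_def det_diagonal)
next
  case (4 m n)
  \<comment> \<open>For the swap here and the shear below, \<open>measure_linear_sufficient\<close>
    reduces the claim to boxes, where the factor is 1.\<close>
  let ?h = "\<lambda>x::real^'n. \<chi> i. x $ Transposition.transpose m n i"
  have lin: "linear ?h"
    by (rule linearI) (simp_all add: vec_eq_iff)
  have "matrix ?h = (\<chi> i. mat 1 $ Transposition.transpose m n i)"
    by (simp add: matrix_def axis_def mat_def vec_eq_iff)
  then have "\<bar>det (matrix ?h)\<bar> = 1"
    by (simp add: det_permute_rows permutes_swap_id sign_swap_id abs_mult)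
  then show ?case
    using measure_linear_sufficient[OF lin 4(2), of 1] by (simp add: measure_transpose_cbox)
next
  case (5 m n)
  let ?h = "\<lambda>x::real^'n. \<chi> i. if i = m then x$m + x$n else x$i"
  have lin: "linear ?h"
    by (rule linearI) (auto simp: vec_eq_iff algebra_simps)
  have "matrix ?h = (\<chi> k. if k = m then row m (mat 1) + 1 *s row n (mat 1) else row k (mat 1))"
    by (auto simp: matrix_def axis_def mat_def vec_eq_iff row_def)
  then have "det (matrix ?h) = det (mat 1 :: real^'n^'n)"
    using det_row_operation[OF 5(1), of "mat 1" 1] by (simp only:)
  then have "\<bar>det (matrix ?h)\<bar> = 1"
    by (simp only: det_I abs_one)
  then show ?case
    using measure_linear_sufficient[OF lin 5(2), of 1] measure_shear_cbox[OF 5(1)]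
    by (simp only: mult_1)
qed

section \<open>The determinant of the vertex matrix\<close>

text \<open>In the Leibniz formula, a permutation that moves \<open>None\<close> picks up a zero
  from row \<open>None\<close>. The remaining ones are the permutations of
  \<open>range Some\<close>, which \<open>map_permutation\<close> matches with those of
  \<open>'n\<close>, sign included.\<close>

lemma det_option_block:
  fixes M :: "'a::comm_ring_1^('n::finite option)^('n option)"
  assumes "\<And>j. M $ None $ Some j = 0"
  shows "det M = M $ None $ None * det (\<chi> i j. M $ Some i $ Some j)"
proof -
  let ?P = "{p. p permutes (UNIV :: 'n option set)}" and ?Q = "{q. q permutes (UNIV :: 'n set)}"
  let ?R = "{p. p permutes range (Some :: 'n \<Rightarrow> _)}"
  let ?t = "\<lambda>p. of_int (sign p) * (\<Prod>i\<in>UNIV. M $ i $ p i)"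
  let ?m = "map_permutation (UNIV :: 'n set) Some"
  have bij: "bij_betw (Some :: 'n \<Rightarrow> _) UNIV (range Some)"
    by (simp add: bij_betw_def)
  have R: "?R = {p \<in> ?P. p None = None}"
  proof (intro set_eqI iffI)
    fix p :: "'n option \<Rightarrow> 'n option" assume "p \<in> ?R"
    then show "p \<in> {p \<in> ?P. p None = None}"
      using permutes_subset[of p "range Some" UNIV] permutes_not_in[of p "range Some" None] by auto
  next
    fix p :: "'n option \<Rightarrow> 'n option" assume "p \<in> {p \<in> ?P. p None = None}"
    then have "\<And>x. x \<notin> range Some \<Longrightarrow> p x = x" "\<And>y. \<exists>!x. p x = y"
      by (auto simp: permutes_def notin_range_Some)
    then show "p \<in> ?R"
      by (simp add: permutes_def)
  qed
  have UNIV_opt: "(UNIV :: 'n option set) = insert None (range Some)"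
    by (auto simp: UNIV_option_conv)
  have "det M = sum ?t ?P"
    by (simp add: det_def)
  also have "\<dots> = sum ?t ?R"
  proof (rule sum.mono_neutral_right)
    show "\<forall>p\<in>?P - ?R. ?t p = 0"
    proof
      fix p assume "p \<in> ?P - ?R"
      then obtain j where "p None = Some j"
        unfolding R by auto
      then have "(\<Prod>i\<in>UNIV. M $ i $ p i) = 0"
        using assms by (intro prod_zero) (auto intro!: exI[of _ None])
      then show "?t p = 0" by simp
    qed
  qed (auto simp: R)
  also have "\<dots> = (\<Sum>q\<in>?Q. ?t (?m q))"
  proof (rule sum.reindex_bij_betw[symmetric], rule bij_betwI[where g = "map_permutation (range Some) the"])
    show "?m \<in> ?Q \<rightarrow> ?R"
      using map_permutation_permutes[OF bij] by auto
    show "map_permutation (range Some) the \<in> ?R \<rightarrow> ?Q"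
      using map_permutation_permutes[of the "range Some" UNIV] by (auto simp: bij_betw_def inj_on_def image_image)
    show "map_permutation (range Some) the (?m q) = q" if "q \<in> ?Q" for q
      using that by (intro map_permutation_compose_inv[OF bij]) auto
    show "?m (map_permutation (range Some) the p) = p" if "p \<in> ?R" for p
      using that by (intro map_permutation_compose_inv) (auto simp: bij_betw_def inj_on_def image_image)
  qed
  also have "\<dots> = (\<Sum>q\<in>?Q. M $ None $ None * (of_int (sign q) * (\<Prod>i\<in>UNIV. M $ Some i $ Some (q i))))"
  proof (rule sum.cong[OF refl])
    fix q assume "q \<in> ?Q"
    then have q: "q permutes UNIV" by simp
    have "?m q None = None"
      using permutes_not_in[OF map_permutation_permutes[OF bij q]] by auto
    moreover have "?m q (Some i) = Some (q i)" for i
      by (simp add: map_permutation_apply)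
    ultimately have "(\<Prod>i\<in>UNIV. M $ i $ ?m q i) = M $ None $ None * (\<Prod>i\<in>UNIV. M $ Some i $ Some (q i))"
      unfolding UNIV_opt by (subst prod.insert) (auto simp: prod.reindex)
    moreover have "sign (?m q) = sign q"
      using q by (intro sign_map_permutation) auto
    ultimately show "?t (?m q) = M $ None $ None * (of_int (sign q) * (\<Prod>i\<in>UNIV. M $ Some i $ Some (q i)))"
      by (simp add: mult_ac)
  qed
  also have "\<dots> = M $ None $ None * det (\<chi> i j. M $ Some i $ Some j)"
    by (simp add: det_def sum_distrib_left)
  finally show ?thesis .
qed

lemma sum_UNIV_option:
  fixes g :: "'n::finite option \<Rightarrow> 'a::comm_monoid_add"
  shows "sum g UNIV = g None + (\<Sum>j\<in>UNIV. g (Some j))"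
  unfolding UNIV_option_conv by (subst sum.insert) (auto simp: sum.reindex)

text \<open>Row operations, collected in the unit triangular \<open>L\<close>, subtract
  \<open>v None\<close> from the coordinate part of every column. Column \<open>None\<close> is then
  zero outside its corner entry 1, so one expansion leaves \<open>edge_mat v\<close>.\<close>

lemma det_vert_mat:
  fixes v :: "'n::finite option \<Rightarrow> real^'n"
  shows "det (vert_mat v) = det (edge_mat v)"
proof -
  \<comment> \<open>\<open>the i\<close> is reached only for \<open>i = Some k\<close>, because the
    case \<open>i = j\<close> comes first.\<close>
  define L :: "real^('n option)^('n option)" where
    "L = (\<chi> i j. if i = j then 1 else if j = None then - (v None $ the i) else 0)"
  let ?A = "L ** vert_mat v"
  have "(\<chi> i j. L $ Some i $ Some j) = mat 1"
    by (simp add: L_def mat_def vec_eq_iff)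
  then have "det L = 1"
    by (subst det_option_block) (auto simp: L_def)
  have A: "?A $ None $ j = 1" "?A $ Some i $ j = v j $ i - v None $ i" for i j
  proof -
    show "?A $ None $ j = 1"
      by (simp add: matrix_matrix_mult_def sum_UNIV_option L_def vert_mat_def)
    have "(\<Sum>k\<in>UNIV. (if i = k then 1 else 0) * v j $ k) = v j $ i"
      by (simp add: if_distrib[of "\<lambda>x. x * _"] cong: if_cong)
    then show "?A $ Some i $ j = v j $ i - v None $ i"
      by (simp add: matrix_matrix_mult_def sum_UNIV_option L_def vert_mat_def cong: if_cong)
  qed
  \<comment> \<open>The zeros of \<open>?A\<close> stand in column \<open>None\<close>, while
    \<open>det_option_block\<close> wants them in row \<open>None\<close>; hence the
    transpose.\<close>
  have "det (vert_mat v) = det (Finite_Cartesian_Product.transpose ?A)"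
    using \<open>det L = 1\<close> by (simp add: det_mul)
  also have "\<dots> = det (\<chi> i j. Finite_Cartesian_Product.transpose ?A $ Some i $ Some j)"
    by (subst det_option_block) (auto simp: Finite_Cartesian_Product.transpose_def A)
  also have "(\<chi> i j. Finite_Cartesian_Product.transpose ?A $ Some i $ Some j)
      = Finite_Cartesian_Product.transpose (edge_mat v)"
    by (simp add: Finite_Cartesian_Product.transpose_def A edge_mat_def vec_eq_iff)
  finally show ?thesis by simp
qed

section \<open>Barycentric coordinates\<close>

text \<open>\<open>convex_hull_finite\<close> puts the weights on points; injectivity of
  \<open>v\<close> moves them to the labels of the vertices.\<close>

lemma simplex_J_eq_combinations:
  assumes "inj v"
  shows "simplex_J v = {\<Sum>j\<in>UNIV. c j *\<^sub>R v j |c. (\<forall>j. 0 \<le> c j) \<and> sum c UNIV = 1}"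
proof (intro set_eqI iffI)
  fix x assume "x \<in> simplex_J v"
  then obtain u where u: "\<forall>y\<in>range v. 0 \<le> u y" "sum u (range v) = 1" "(\<Sum>y\<in>range v. u y *\<^sub>R y) = x"
    unfolding simplex_J_def by (auto simp: convex_hull_finite)
  then show "x \<in> {\<Sum>j\<in>UNIV. c j *\<^sub>R v j |c. (\<forall>j. 0 \<le> c j) \<and> sum c UNIV = 1}"
    using assms by (intro CollectI exI[of _ "u \<circ> v"]) (auto simp: sum.reindex)
next
  fix x assume "x \<in> {\<Sum>j\<in>UNIV. c j *\<^sub>R v j |c. (\<forall>j. 0 \<le> c j) \<and> sum c UNIV = 1}"
  then show "x \<in> simplex_J v"
    unfolding simplex_J_def
    by clarify (rule convex_sum[OF _ convex_convex_hull]; simp add: hull_inc)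
qed

lemma edge_mat_mult_vec: "edge_mat v *v y = (\<Sum>i\<in>UNIV. y $ i *\<^sub>R (v (Some i) - v None))"
  by (simp add: matrix_vector_mult_def edge_mat_def vec_eq_iff mult.commute)

lemma invertible_edge_mat:
  assumes inj: "inj v" and indep: "\<not> affine_dependent (range v)"
  shows "invertible (edge_mat v)"
proof -
  have "c i = 0" if c: "(\<Sum>i\<in>UNIV. c i *s column i (edge_mat v)) = 0" for c :: "'a \<Rightarrow> real" and i
  proof -
    \<comment> \<open>A linear relation between the edges becomes an affine one between the
      vertices: the weight at \<open>v None\<close> is chosen to make the total zero.\<close>
    define U where "U = (\<lambda>j. case j of None \<Rightarrow> - sum c UNIV | Some i \<Rightarrow> c i) \<circ> inv v"
    have Uv: "U (v None) = - sum c UNIV" "U (v (Some i)) = c i" for i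
      using inj by (simp_all add: U_def)
    have col: "column i (edge_mat v) = v (Some i) - v None" for i
      by (simp add: column_def edge_mat_def vec_eq_iff)
    have "sum U (range v) = 0"
      using inj by (simp add: sum.reindex sum_UNIV_option Uv)
    moreover have "(\<Sum>x\<in>range v. U x *\<^sub>R x) = (\<Sum>i\<in>UNIV. c i *\<^sub>R (v (Some i) - v None))"
      using inj by (simp add: sum.reindex sum_UNIV_option Uv scaleR_sum_left scaleR_diff_right sum_subtractf)
    moreover have "\<dots> = 0"
      using c by (simp add: col scalar_mult_eq_scaleR)
    ultimately have "\<forall>x\<in>range v. U x = 0"
      using indep by (simp add: affine_dependent_explicit_finite) blast
    then show "c i = 0"
      using Uv(2)[of i] by simp
  qed
  then show ?thesis
    using matrix_left_invertible_independent_columns[of "edge_mat v"]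
    by (auto simp: invertible_left_inverse)
qed

text \<open>For an invertible \<open>edge_mat v\<close>, \<open>y\<close> solves
  \<open>x = v None + edge_mat v *v y\<close>, and \<open>None\<close> receives the remaining
  weight. The formula is affine on the whole space, which makes continuity immediate.\<close>

definition barycentric :: "('n::finite option \<Rightarrow> real^'n) \<Rightarrow> 'n option \<Rightarrow> real^'n \<Rightarrow> real" where
  "barycentric v j x =
    (let y = matrix_inv (edge_mat v) *v (x - v None)
     in case j of None \<Rightarrow> 1 - (\<Sum>i\<in>UNIV. y $ i) | Some i \<Rightarrow> y $ i)"

text \<open>Weights of sum 1 turn the combination into \<open>v None\<close> plus
  \<open>edge_mat v\<close> applied to the weights at \<open>Some i\<close>, and the inverse matrix
  recovers these. In particular the weights are unique.\<close>

lemma barycentric_combination: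
  assumes inv: "invertible (edge_mat v)" and c: "sum c UNIV = 1"
  shows "barycentric v j (\<Sum>k\<in>UNIV. c k *\<^sub>R v k) = c j"
proof -
  have c0: "c None = 1 - (\<Sum>i\<in>UNIV. c (Some i))"
    using c by (simp add: sum_UNIV_option)
  have "(\<Sum>k\<in>UNIV. c k *\<^sub>R v k) - v None = edge_mat v *v (\<chi> i. c (Some i))"
    by (simp add: edge_mat_mult_vec sum_UNIV_option c0 scaleR_sum_left scaleR_diff_right sum_subtractf
        scaleR_diff_left)
  moreover have "matrix_inv (edge_mat v) ** edge_mat v = mat 1"
    using inv unfolding invertible_def matrix_inv_def by (metis (mono_tags, lifting) someI_ex)
  ultimately show ?thesis
    by (cases j) (simp_all add: barycentric_def c0 matrix_vector_mul_assoc)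
qed

lemma continuous_on_matrix_vector_mult [continuous_intros]:
  fixes A :: "real^'n^'m"
  shows "continuous_on S g \<Longrightarrow> continuous_on S (\<lambda>x. A *v g x)"
  by (rule bounded_linear.continuous_on[OF matrix_vector_mul_bounded_linear])

lemma continuous_on_barycentric: "continuous_on S (barycentric v j)"
  unfolding barycentric_def Let_def
  by (cases j) (auto intro!: continuous_intros)

lemma mu_hom_scaleR: "mu_hom f v (z *\<^sub>R u) z = z * mu_hom f v u 1"
proof -
  have "z *\<^sub>R u - z *\<^sub>R v None = z *\<^sub>R (u - v None)"
    by (simp add: algebra_simps)
  then show ?thesis
    by (simp add: mu_hom_def matrix_vector_mult_scaleR algebra_simps)
qed

text \<open>The terms carrying \<open>f (v None)\<close> collect into the coordinate at
  \<open>None\<close>. This reduces the integral of the interpolant to integrals of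
  coordinates.\<close>

lemma mu_hom_eq_barycentric:
  "mu_hom f v u 1 = (\<Sum>j\<in>UNIV. f (v j) * barycentric v j u)"
  by (simp add: mu_hom_def sum_UNIV_option barycentric_def Let_def wvec_def inner_vec_def
      algebra_simps sum_subtractf sum.distrib sum_distrib_left)

lemma continuous_on_mu_hom [continuous_intros]:
  "continuous_on S g \<Longrightarrow> continuous_on S h \<Longrightarrow> continuous_on S (\<lambda>x. mu_hom f v (g x) (h x))"
  unfolding mu_hom_def by (intro continuous_intros)

lemma compact_simplex_J: "compact (simplex_J v)"
  unfolding simplex_J_def by (intro compact_convex_hull finite_imp_compact) simp

lemma barycentric_bounds:
  assumes "inj v" "invertible (edge_mat v)" "x \<in> simplex_J v"
  shows "0 \<le> barycentric v j x" "barycentric v j x \<le> 1"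
proof -
  obtain c where c: "x = (\<Sum>k\<in>UNIV. c k *\<^sub>R v k)" "\<forall>j. 0 \<le> c j" "sum c UNIV = 1"
    using assms by (auto simp: simplex_J_eq_combinations)
  then have "c j \<le> 1"
    using member_le_sum[of j UNIV c] by auto
  then show "0 \<le> barycentric v j x" "barycentric v j x \<le> 1"
    using c assms(2) by (auto simp: barycentric_combination)
qed

text \<open>The homothety with centre \<open>v j\<close> multiplies all weights by
  \<open>1 - t\<close> and adds \<open>t\<close> to the weight at \<open>j\<close>. Weights with
  \<open>t \<le> c j\<close> are exactly those that arise in this way.\<close>

lemma barycentric_superlevel:
  assumes inj: "inj v" and inv: "invertible (edge_mat v)" and t: "0 \<le> t" "t < 1"
  shows "{x \<in> simplex_J v. t \<le> barycentric v j x} = (\<lambda>u. (1 - t) *\<^sub>R u + t *\<^sub>R v j) ` simplex_J v"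
proof -
  have upd: "(1 - t) *\<^sub>R (\<Sum>k\<in>UNIV. c k *\<^sub>R v k) + t *\<^sub>R v j
      = (\<Sum>k\<in>UNIV. ((1 - t) * c k + (if k = j then t else 0)) *\<^sub>R v k)" for c :: "_ \<Rightarrow> real"
    by (simp add: scaleR_add_left sum.distrib scaleR_sum_right if_distrib[of "\<lambda>a. a *\<^sub>R _"] cong: if_cong)
  have upd1: "(\<Sum>k\<in>UNIV. (1 - t) * c k + (if k = j then t else 0)) = 1" if "sum c UNIV = 1" for c
    using that by (simp add: sum.distrib flip: sum_distrib_left)
  show ?thesis
  proof (intro set_eqI iffI)
    fix x assume "x \<in> {x \<in> simplex_J v. t \<le> barycentric v j x}"
    then obtain c where c: "x = (\<Sum>k\<in>UNIV. c k *\<^sub>R v k)" "\<forall>j. 0 \<le> c j" "sum c UNIV = 1" "t \<le> c j"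
      using inj inv by (auto simp: simplex_J_eq_combinations barycentric_combination)
    \<comment> \<open>The weights of the preimage, found by solving for them;
      \<open>0 \<le> d j\<close> is what \<open>t \<le> c j\<close> provides, and the division is
      where \<open>t < 1\<close> enters.\<close>
    define d where "d k = (c k - (if k = j then t else 0)) / (1 - t)" for k
    have "(1 - t) * d k + (if k = j then t else 0) = c k" for k
      using t by (simp add: d_def)
    then have "x = (1 - t) *\<^sub>R (\<Sum>k\<in>UNIV. d k *\<^sub>R v k) + t *\<^sub>R v j"
      by (simp add: upd c(1))
    moreover have "sum d UNIV = 1" "\<forall>k. 0 \<le> d k"
      using c t by (auto simp: d_def sum_subtractf simp flip: sum_divide_distrib)
    ultimately show "x \<in> (\<lambda>u. (1 - t) *\<^sub>R u + t *\<^sub>R v j) ` simplex_J v"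
      using inj by (auto simp: simplex_J_eq_combinations)
  next
    fix x assume "x \<in> (\<lambda>u. (1 - t) *\<^sub>R u + t *\<^sub>R v j) ` simplex_J v"
    then obtain c where c: "x = (1 - t) *\<^sub>R (\<Sum>k\<in>UNIV. c k *\<^sub>R v k) + t *\<^sub>R v j"
        "\<forall>j. 0 \<le> c j" "sum c UNIV = 1"
      using inj by (auto simp: simplex_J_eq_combinations)
    let ?d = "\<lambda>k. (1 - t) * c k + (if k = j then t else 0)"
    have x: "x = (\<Sum>k\<in>UNIV. ?d k *\<^sub>R v k)" and d: "\<forall>k. 0 \<le> ?d k" "sum ?d UNIV = 1" "t \<le> ?d j"
      using c t upd1[of c] by (simp_all add: upd)
    have "x \<in> simplex_J v"
      unfolding simplex_J_eq_combinations[OF inj] by (intro CollectI exI[of _ ?d] conjI x d)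
    moreover have "barycentric v j x = ?d j"
      unfolding x by (rule barycentric_combination[OF inv d(2)])
    ultimately show "x \<in> {x \<in> simplex_J v. t \<le> barycentric v j x}"
      using d(3) by simp
  qed
qed

section \<open>Volume of the simplex\<close>

text \<open>The simplex is a translate of the image under \<open>edge_mat v\<close> of the standard
  simplex, whose volume is \<open>1 / d!\<close>. Degenerate simplices are covered: both sides are
  then zero.\<close>

lemma measure_simplex_J:
  fixes v :: "'n::finite option \<Rightarrow> real^'n"
  shows "measure lebesgue (simplex_J v) = \<bar>det (edge_mat v)\<bar> / fact CARD('n)"
proof -
  let ?std = "convex hull (insert 0 Basis) :: (real^'n) set"
  have compact: "compact ?std"
    by (intro compact_convex_hull finite_imp_compact) simp
  have Basis: "(Basis :: (real^'n) set) = range (\<lambda>i. axis i 1)"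
    by (auto simp: Basis_vec_def)
  have "edge_mat v *v axis i 1 = v (Some i) - v None" for i
    by (simp add: matrix_vector_mult_basis column_def edge_mat_def vec_eq_iff)
  then have "range v = (+) (v None) ` (*v) (edge_mat v) ` insert 0 Basis"
    by (simp add: Basis image_image UNIV_option_conv)
  then have "simplex_J v = (+) (v None) ` (*v) (edge_mat v) ` ?std"
    by (simp only: simplex_J_def convex_hull_translation convex_hull_linear_image
        matrix_vector_mul_linear)
  then have "measure lebesgue (simplex_J v) = \<bar>det (edge_mat v)\<bar> * measure lebesgue ?std"
    using measure_linear_image_finite[OF matrix_vector_mul_linear[of "edge_mat v"] lmeasurable_compact[OF compact]]
    by (simp add: measure_translation)
  also have "measure lebesgue ?std = 1 / fact CARD('n)"
    using content_std_simplex[where 'a="real^'n"] borel_compact[OF compact] by (simp add: measure_completion)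
  finally show ?thesis by simp
qed

section \<open>Regions between graphs and integrals over scaled sets\<close>

lemma integrable_on_compact:
  fixes g :: "'a::euclidean_space \<Rightarrow> real"
  assumes "compact K" "continuous_on K g"
  shows "g integrable_on K"
  using borel_integrable_compact[OF assms]
  by (intro set_borel_integral_eq_integral) (simp add: set_integrable_def)

text \<open>Compactness supplies the Borel measurability that Tonelli's theorem asks for, and later
  the finite measure of \<open>P0\<close>.\<close>

lemma compact_between_graphs:
  fixes g h :: "'a::euclidean_space \<Rightarrow> real"
  assumes K: "compact K" and g: "continuous_on K g" and h: "continuous_on K h"
  shows "compact {(x, y). x \<in> K \<and> g x \<le> y \<and> y \<le> h x}" (is "compact ?R")
proof -
  obtain a where a: "\<And>x. x \<in> K \<Longrightarrow> a \<le> g x"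
    using compact_imp_bounded[OF compact_continuous_image[OF g K]]
    by (auto simp: bounded_real abs_le_iff) (metis minus_le_iff)
  obtain b where b: "\<And>x. x \<in> K \<Longrightarrow> h x \<le> b"
    using compact_imp_bounded[OF compact_continuous_image[OF h K]]
    by (auto simp: bounded_real abs_le_iff)
  \<comment> \<open>The functions are continuous only on \<open>K\<close>, so the two inequalities
    are shown to be closed inside this compact product, which contains the region.\<close>
  let ?C = "K \<times> {a..b}"
  have C: "compact ?C"
    by (intro compact_Times K compact_Icc)
  have cont: "continuous_on ?C (\<lambda>p. g (fst p))" "continuous_on ?C (\<lambda>p. h (fst p))"
    by (auto intro!: continuous_on_compose2[OF g] continuous_on_compose2[OF h] continuous_intros)
  have "closed {p \<in> ?C. g (fst p) \<le> snd p}" "closed {p \<in> ?C. snd p \<le> h (fst p)}"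
    using cont compact_imp_closed[OF C] by (auto intro!: continuous_on_closed_Collect_le continuous_intros)
  then have "compact (?C \<inter> ({p \<in> ?C. g (fst p) \<le> snd p} \<inter> {p \<in> ?C. snd p \<le> h (fst p)}))"
    by (intro compact_Int_closed C closed_Int)
  also have "?C \<inter> ({p \<in> ?C. g (fst p) \<le> snd p} \<inter> {p \<in> ?C. snd p \<le> h (fst p)}) = ?R"
    using a b by (fastforce intro: order_trans)
  finally show ?thesis .
qed

lemma emeasure_between_graphs:
  fixes g h :: "'a::euclidean_space \<Rightarrow> real"
  assumes K: "compact K" and g: "continuous_on K g" and h: "continuous_on K h"
    and le: "\<And>x. x \<in> K \<Longrightarrow> g x \<le> h x"
  shows "emeasure lborel {(x, y). x \<in> K \<and> g x \<le> y \<and> y \<le> h x} = ennreal (integral K (\<lambda>x. h x - g x))"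
    (is "emeasure _ ?R = _")
proof -
  have "?R \<in> sets (lborel \<Otimes>\<^sub>M lborel)"
    unfolding lborel_prod using borel_compact[OF compact_between_graphs[OF K g h]] by simp
  then have "emeasure lborel ?R = (\<integral>\<^sup>+x. emeasure lborel (Pair x -` ?R) \<partial>lborel)"
    by (simp add: lborel.emeasure_pair_measure_alt flip: lborel_prod)
  also have "\<dots> = (\<integral>\<^sup>+x. ennreal (h x - g x) * indicator K x \<partial>lborel)"
  proof (rule nn_integral_cong)
    fix x
    show "emeasure lborel (Pair x -` ?R) = ennreal (h x - g x) * indicator K x"
    proof (cases "x \<in> K")
      case True
      then have "Pair x -` ?R = {g x..h x}" by auto
      then show ?thesis using True le by simp
    qed simp
  qed
  also have "\<dots> = ennreal (integral K (\<lambda>x. h x - g x))"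
    using le K g h
    by (intro nn_integral_has_integral_lebesgue' integrable_integral integrable_on_compact
        continuous_intros) auto
  finally show ?thesis .
qed

text \<open>The indicator extends \<open>g\<close> by zero from the compact set, so the scaling rule
  for \<open>lborel\<close> on the whole space applies.\<close>

lemma integral_scaleR_image:
  fixes g :: "'a::euclidean_space \<Rightarrow> real"
  assumes K: "compact K" and g: "continuous_on ((\<lambda>x. z *\<^sub>R x) ` K) g" and z: "0 < z"
  shows "integral ((\<lambda>x. z *\<^sub>R x) ` K) g = z ^ DIM('a) * integral K (\<lambda>x. g (z *\<^sub>R x))"
proof -
  let ?K = "(\<lambda>x. z *\<^sub>R x) ` K"
  have K': "compact ?K"
    using K by (rule compact_scaling)
  have gz: "continuous_on K (\<lambda>x. g (z *\<^sub>R x))"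
    by (rule continuous_on_compose2[OF g]) (auto intro!: continuous_intros)
  have int: "integrable lborel (\<lambda>x. indicator ?K x *\<^sub>R g x)"
    using K' g by (rule borel_integrable_compact)
  then have meas [measurable]: "(\<lambda>x. indicator ?K x *\<^sub>R g x) \<in> borel_measurable borel"
    by simp
  have ind: "indicator ?K (z *\<^sub>R x) = (indicator K x :: real)" for x
    using z by (auto simp: indicator_def)
  have "integral ?K g = (\<integral>x. indicator ?K x *\<^sub>R g x \<partial>lborel)"
    using set_borel_integral_eq_integral(2)[of ?K g] int
    by (simp add: set_integrable_def set_lebesgue_integral_def)
  \<comment> \<open>Only the measure is rewritten: \<open>lborel\<close> is its own image under
    scaling by \<open>z\<close>, with density \<open>\<bar>z\<bar> ^ DIM('a)\<close>.\<close>
  also have "\<dots> = (\<integral>x. indicator ?K x *\<^sub>R g x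
      \<partial>density (distr lborel borel (\<lambda>x. 0 + z *\<^sub>R x)) (\<lambda>_. ennreal (\<bar>z\<bar> ^ DIM('a))))"
    using z lborel_affine[of z "0::'a"] by simp
  also have "\<dots> = z ^ DIM('a) * (\<integral>x. indicator K x *\<^sub>R g (z *\<^sub>R x) \<partial>lborel)"
    using z meas
    by (subst integral_density; simp; subst integral_distr; simp add: ind)
  also have "(\<integral>x. indicator K x *\<^sub>R g (z *\<^sub>R x) \<partial>lborel) = integral K (\<lambda>x. g (z *\<^sub>R x))"
    using set_borel_integral_eq_integral(2)[of K "\<lambda>x. g (z *\<^sub>R x)"] borel_integrable_compact[OF K gz]
    by (simp add: set_integrable_def set_lebesgue_integral_def)
  finally show ?thesis .
qed

lemma has_integral_power_unit: "((\<lambda>x::real. x ^ k) has_integral 1 / Suc k) {0..1}"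
proof -
  have "((\<lambda>x::real. x ^ Suc k / Suc k) has_real_derivative x ^ k) (at x within A)" for x A
    by (intro derivative_eq_intros) auto
  then have "((\<lambda>x::real. x ^ k) has_integral 1 ^ Suc k / Suc k - 0 ^ Suc k / Suc k) {0..1}"
    by (intro fundamental_theorem_of_calculus)
      (auto simp flip: has_real_derivative_iff_has_vector_derivative simp del: of_nat_Suc power_Suc)
  then show ?thesis by simp
qed

lemma has_integral_power_unit_reflected:
  "((\<lambda>x::real. (1 - x) ^ k) has_integral 1 / Suc k) {0..1}"
proof -
  have "((\<lambda>x::real. - ((1 - x) ^ Suc k / Suc k)) has_real_derivative (1 - x) ^ k) (at x within A)" for x A
    by (intro derivative_eq_intros) auto
  then have "((\<lambda>x::real. (1 - x) ^ k) has_integral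
      - ((1 - 1) ^ Suc k / Suc k) - - ((1 - 0) ^ Suc k / Suc k)) {0..1}"
    by (intro fundamental_theorem_of_calculus)
      (auto simp flip: has_real_derivative_iff_has_vector_derivative simp del: of_nat_Suc power_Suc)
  then show ?thesis by simp
qed

section \<open>The integral of a barycentric coordinate\<close>

text \<open>The region under the graph is measured twice: slices at fixed \<open>t\<close> are
  homothetic copies of the simplex with ratio \<open>1 - t\<close>, and slices at fixed
  \<open>x\<close> give the integral.\<close>

lemma integral_barycentric:
  fixes v :: "'n::finite option \<Rightarrow> real^'n"
  assumes inj: "inj v" and inv: "invertible (edge_mat v)"
  shows "integral (simplex_J v) (barycentric v j) = measure lebesgue (simplex_J v) / (CARD('n) + 1)"
proof -
  let ?J = "simplex_J v" and ?b = "barycentric v j" and ?V = "measure lebesgue (simplex_J v)"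
  let ?R = "{(x, y). x \<in> ?J \<and> 0 \<le> y \<and> y \<le> ?b x}"
  have J: "compact ?J" by (rule compact_simplex_J)
  have "?R \<in> sets (lborel \<Otimes>\<^sub>M lborel)"
    unfolding lborel_prod
    using borel_compact[OF compact_between_graphs[OF J _ continuous_on_barycentric]] by simp
  then have "emeasure lborel ?R = (\<integral>\<^sup>+t. emeasure lborel ((\<lambda>x. (x, t)) -` ?R) \<partial>lborel)"
    by (simp add: lborel_pair.emeasure_pair_measure_alt2 flip: lborel_prod)
  also have "\<dots> = (\<integral>\<^sup>+t. ennreal ((1 - t) ^ CARD('n) * ?V) * indicator {0..1} t \<partial>lborel)"
  \<comment> \<open>The level \<open>t = 1\<close>, a null set, is left out because
    \<open>barycentric_superlevel\<close> needs \<open>t < 1\<close>.\<close>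
  proof (rule nn_integral_cong_AE, use AE_lborel_singleton[of 1] in eventually_elim)
    fix t :: real assume "t \<noteq> 1"
    let ?S = "(\<lambda>x. (x, t)) -` ?R"
    show "emeasure lborel ?S = ennreal ((1 - t) ^ CARD('n) * ?V) * indicator {0..1} t"
    proof (cases "t \<in> {0..1}")
      case True
      with \<open>t \<noteq> 1\<close> have t: "0 \<le> t" "t < 1" by auto
      have S: "?S = (\<lambda>u. (1 - t) *\<^sub>R u + t *\<^sub>R v j) ` ?J"
        unfolding barycentric_superlevel[OF inj inv t, symmetric] using t by auto
      have "compact ((\<lambda>u. (1 - t) *\<^sub>R u + t *\<^sub>R v j) ` ?J)"
        by (intro compact_continuous_image J continuous_intros)
      then have "emeasure lborel ?S = emeasure lebesgue ?S"
        unfolding S by (simp add: borel_compact)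
      also have "\<dots> = ennreal ((1 - t) ^ CARD('n)) * emeasure lebesgue ?J"
        unfolding S using t by (simp add: emeasure_lebesgue_affine)
      also have "emeasure lebesgue ?J = ennreal ?V"
        using lmeasurable_compact[OF J] by (simp add: emeasure_eq_measure2)
      finally show ?thesis
        using True by (simp add: ennreal_mult')
    next
      case False
      then have "?S = {}"
        using barycentric_bounds(2)[OF inj inv, of _ j] by (auto intro: order_trans)
      then have "emeasure lborel ?S = 0"
        by (simp only: emeasure_empty)
      moreover have "indicator {0..1} t = (0::ennreal)"
        using False by (rule indicator_simps)
      ultimately show ?thesis by (simp only: mult_zero_right)
    qed
  qed
  also have "\<dots> = ennreal (?V / (CARD('n) + 1))"
  proof (rule nn_integral_has_integral_lebesgue')
    have "((\<lambda>t::real. (1 - t) ^ CARD('n) * ?V) has_integral 1 / Suc CARD('n) * ?V) {0..1}"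
      by (intro has_integral_mult_left has_integral_power_unit_reflected)
    then show "((\<lambda>t::real. (1 - t) ^ CARD('n) * ?V) has_integral ?V / (CARD('n) + 1)) {0..1}"
      by (simp add: add.commute)
  qed simp
  finally have "ennreal (integral ?J ?b) = ennreal (?V / (CARD('n) + 1))"
    using emeasure_between_graphs[OF J continuous_on_const continuous_on_barycentric, of 0 v j]
      barycentric_bounds[OF inj inv] by simp
  \<comment> \<open>Nonnegativity is needed to cancel \<open>ennreal\<close>, which sends all
    negative numbers to zero.\<close>
  moreover have "0 \<le> integral ?J ?b"
    using barycentric_bounds[OF inj inv]
    by (intro integral_nonneg integrable_on_compact J continuous_on_barycentric) auto
  ultimately show ?thesis
    by (simp add: ennreal_inj)
qed

section \<open>The affine interpolant as an upper bound, and its integral\<close>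

text \<open>Jensen's inequality with the barycentric weights of \<open>u\<close>.\<close>

lemma convex_on_le_mu_hom:
  assumes inj: "inj v" and inv: "invertible (edge_mat v)"
    and conv: "convex_on (simplex_J v) f" and u: "u \<in> simplex_J v"
  shows "f u \<le> mu_hom f v u 1"
proof -
  obtain c where c: "u = (\<Sum>k\<in>UNIV. c k *\<^sub>R v k)" "\<forall>j. 0 \<le> c j" "sum c UNIV = 1"
    using inj u by (auto simp: simplex_J_eq_combinations)
  have "v j \<in> simplex_J v" for j
    unfolding simplex_J_def by (simp add: hull_inc)
  then have "f (\<Sum>k\<in>UNIV. c k *\<^sub>R v k) \<le> (\<Sum>k\<in>UNIV. c k * f (v k))"
    using c conv by (intro convex_on_sum) auto
  also have "\<dots> = mu_hom f v u 1"
    by (simp add: mu_hom_eq_barycentric c barycentric_combination[OF inv c(3)] mult.commute)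
  finally show ?thesis
    by (simp add: c(1))
qed

text \<open>Each \<open>z u\<close> lies on the segment from 0 to \<open>u\<close>. This keeps the
  base of every slice inside the set on which \<open>f\<close> is continuous and convex.\<close>

lemma scaled_set_subset_hull:
  assumes "0 \<le> z" "z \<le> 1"
  shows "scaled_set z S \<subseteq> convex hull (insert 0 S)"
proof
  fix x assume "x \<in> scaled_set z S"
  then obtain u where u: "u \<in> S" "x = z *\<^sub>R u"
    by (auto simp: scaled_set_def)
  have "(1 - z) *\<^sub>R 0 + z *\<^sub>R u \<in> convex hull (insert 0 S)"
    using assms u(1) by (intro convexD[OF convex_convex_hull] hull_inc) auto
  then show "x \<in> convex hull (insert 0 S)"
    by (simp add: u(2))
qed

lemma integral_mu_hom:
  fixes v :: "'n::finite option \<Rightarrow> real^'n"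
  assumes inj: "inj v" and inv: "invertible (edge_mat v)"
  shows "integral (simplex_J v) (\<lambda>u. mu_hom f v u 1)
    = \<bar>det (edge_mat v)\<bar> / fact (CARD('n) + 1) * (\<Sum>j\<in>UNIV. f (v j))"
proof -
  have "integral (simplex_J v) (\<lambda>u. mu_hom f v u 1)
      = (\<Sum>j\<in>UNIV. f (v j) * integral (simplex_J v) (barycentric v j))"
    unfolding mu_hom_eq_barycentric
    by (subst integral_sum)
      (auto intro!: integrable_on_compact compact_simplex_J continuous_intros continuous_on_barycentric)
  also have "\<dots> = (\<Sum>j\<in>UNIV. f (v j)) * (\<bar>det (edge_mat v)\<bar> / fact CARD('n) / (CARD('n) + 1))"
    by (simp only: integral_barycentric[OF inj inv] measure_simplex_J sum_distrib_right)
  also have "\<dots> = \<bar>det (edge_mat v)\<bar> / fact (CARD('n) + 1) * (\<Sum>j\<in>UNIV. f (v j))"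
    by (simp add: algebra_simps)
  finally show ?thesis .
qed

section \<open>The volume by slicing at height \<open>z\<close>\<close>

theorem theorem2:
  fixes v :: "'n::finite option \<Rightarrow> real^'n" and f :: "real^'n \<Rightarrow> real"
  assumes simplex: "inj v" "\<not> affine_dependent (range v)"
    and nonneg: "\<forall>x\<in>simplex_J v. \<forall>i. x $ i \<ge> 0"
    and nozero: "0 \<notin> simplex_J v"
    and f0: "f 0 = 0"
    and fcont: "continuous_on (convex hull (insert 0 (simplex_J v))) f"
    and fconv: "convex_on (convex hull (insert 0 (simplex_J v))) f"
  shows "P0 f v \<in> sets lebesgue \<and>
    measure lebesgue (P0 f v) =
      1 / fact (CARD('n) + 2) * \<bar>det (vert_mat v)\<bar> * (\<Sum>j\<in>UNIV. f (v j))
      - integral {0..1} (\<lambda>z. z ^ CARD('n) * integral (simplex_J v) (\<lambda>x. f (z *\<^sub>R x)))"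
proof -
  let ?d = "CARD('n)" and ?J = "simplex_J v" and ?P = "P0 f v"
  let ?D = "convex hull (insert 0 ?J)"
  have inv: "invertible (edge_mat v)"
    using simplex by (rule invertible_edge_mat)
  note inj = simplex(1)
  have J: "compact ?J" by (rule compact_simplex_J)
  have JD: "?J \<subseteq> ?D"
    using hull_subset[of "insert 0 ?J" convex] by simp
  have zJ: "compact (scaled_set z ?J)" for z
    unfolding scaled_set_def by (rule compact_scaling[OF J])
  have cont_zJ: "continuous_on (scaled_set z ?J) f" if "z \<in> {0..1}" for z
    using that by (intro continuous_on_subset[OF fcont] scaled_set_subset_hull) auto
  have le: "f (z *\<^sub>R u) \<le> z * mu_hom f v u 1" if "u \<in> ?J" "z \<in> {0..1}" for u z
  proof -
    \<comment> \<open>Convexity is used twice: along the segment from 0, where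
      \<open>f 0 = 0\<close> removes a term, and then on the simplex itself.\<close>
    have "f ((1 - z) *\<^sub>R 0 + z *\<^sub>R u) \<le> (1 - z) * f 0 + z * f u"
      using that JD by (intro convex_onD[OF fconv]) (auto intro: hull_inc)
    also have "\<dots> \<le> z * mu_hom f v u 1"
      using that convex_on_le_mu_hom[OF inj inv convex_on_subset[OF fconv JD]]
      by (auto simp: f0 simplex_J_def intro!: mult_left_mono)
    finally show ?thesis by simp
  qed

  \<comment> \<open>Up to the order of coordinates, \<open>P0\<close> is the region between two
    graphs over the compact truncated cone \<open>?C\<close>; hence it is compact.\<close>
  let ?C = "(\<lambda>(u, z). (z *\<^sub>R u, z)) ` (?J \<times> {0..1::real})"
  let ?R = "{(p, y). p \<in> ?C \<and> f (fst p) \<le> y \<and> y \<le> mu_hom f v (fst p) (snd p)}"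
  have "compact ?C"
    by (intro compact_continuous_image compact_Times J compact_Icc)
      (auto simp: case_prod_unfold intro!: continuous_intros)
  moreover have "continuous_on ?C (\<lambda>p. f (fst p))"
    using scaled_set_subset_hull[of _ ?J]
    by (intro continuous_on_compose2[OF fcont] continuous_intros) (fastforce simp: scaled_set_def)
  moreover have "continuous_on ?C (\<lambda>p. mu_hom f v (fst p) (snd p))"
    by (intro continuous_intros)
  ultimately have "compact ?R"
    by (rule compact_between_graphs)
  then have "compact ((\<lambda>q. ((fst (fst q), snd q), snd (fst q))) ` ?R)"
    by (intro compact_continuous_image continuous_intros)
  moreover have "?P = (\<lambda>q. ((fst (fst q), snd q), snd (fst q))) ` ?R"
  proof (intro equalityI subsetI)
    fix q assume "q \<in> ?P"
    then obtain u y z where "q = ((z *\<^sub>R u, y), z)" "u \<in> ?J" "z \<in> {0..1}"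
        "f (z *\<^sub>R u) \<le> y" "y \<le> mu_hom f v (z *\<^sub>R u) z"
      by (auto simp: P0_def scaled_set_def)
    then show "q \<in> (\<lambda>q. ((fst (fst q), snd q), snd (fst q))) ` ?R"
      by (intro image_eqI[of _ _ "((z *\<^sub>R u, z), y)"]) auto
  qed (auto simp: P0_def scaled_set_def)
  ultimately have P: "compact ?P" by simp

  define G where "G z = integral (scaled_set z ?J) (\<lambda>x. mu_hom f v x z - f x)" for z
  let ?slice = "\<lambda>z. (\<lambda>p. (p, z)) -` ?P"
  have slice: "emeasure lborel (?slice z) = ennreal (G z) \<and> 0 \<le> G z" if z: "z \<in> {0..1}" for z
  proof
    have le': "f x \<le> mu_hom f v x z" if "x \<in> scaled_set z ?J" for x
      using that le[OF _ z] by (auto simp: scaled_set_def mu_hom_scaleR)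
    have "?slice z = {(x, y). x \<in> scaled_set z ?J \<and> f x \<le> y \<and> y \<le> mu_hom f v x z}"
      using z by (auto simp: P0_def)
    then show "emeasure lborel (?slice z) = ennreal (G z)"
      unfolding G_def using le'
      by (simp add: emeasure_between_graphs[OF zJ cont_zJ[OF z]] continuous_intros)
    show "0 \<le> G z"
      unfolding G_def using le' z
      by (intro integral_nonneg integrable_on_compact zJ continuous_intros cont_zJ) auto
  qed
  have slice_empty: "?slice z = {}" if "z \<notin> {0..1}" for z
    using that by (auto simp: P0_def)
  have G: "G z = z ^ (?d + 1) * integral ?J (\<lambda>u. mu_hom f v u 1)
      - z ^ ?d * integral ?J (\<lambda>u. f (z *\<^sub>R u))" if z: "z \<in> {0..1}" for z
  proof (cases "z = 0")
    case True
    \<comment> \<open>\<open>integral_scaleR_image\<close> needs \<open>0 < z\<close>. At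
      \<open>z = 0\<close> the base is negligible, and both powers on the right vanish because
      \<open>CARD('n)\<close> is positive.\<close>
    have "scaled_set 0 ?J \<subseteq> {0}"
      by (auto simp: scaled_set_def)
    then have "negligible (scaled_set 0 ?J)"
      by (rule negligible_subset[rotated]) simp
    then show ?thesis
      using True by (simp add: G_def integral_negligible)
  next
    case False
    have fz: "continuous_on ?J (\<lambda>u. f (z *\<^sub>R u))"
      by (rule continuous_on_compose2[OF cont_zJ[OF z]]) (auto simp: scaled_set_def intro!: continuous_intros)
    have "G z = z ^ ?d * integral ?J (\<lambda>u. z * mu_hom f v u 1 - f (z *\<^sub>R u))"
      using False z cont_zJ[OF z]
      by (simp add: G_def scaled_set_def integral_scaleR_image[OF J] continuous_intros mu_hom_scaleR)
    also have "integral ?J (\<lambda>u. z * mu_hom f v u 1 - f (z *\<^sub>R u))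
        = z * integral ?J (\<lambda>u. mu_hom f v u 1) - integral ?J (\<lambda>u. f (z *\<^sub>R u))"
      by (subst integral_diff) (auto intro!: integrable_on_compact J continuous_intros fz)
    finally show ?thesis
      by (simp add: algebra_simps)
  qed

  have Pborel: "?P \<in> sets borel"
    using P by (rule borel_compact)
  then have Ppair: "?P \<in> sets (lborel \<Otimes>\<^sub>M lborel)"
    unfolding lborel_prod by simp
  \<comment> \<open>\<open>?g\<close> is \<open>G\<close> extended by zero. As a function of slice
    measures it is measurable, so no continuity of \<open>G\<close> has to be shown.\<close>
  let ?g = "\<lambda>z. enn2real (emeasure lborel (?slice z))"
  have g: "?g = (\<lambda>z. if z \<in> {0..1} then G z else 0)"
    using slice slice_empty by (auto simp: fun_eq_iff)
  have "(\<lambda>z. emeasure lborel (?slice z)) \<in> borel_measurable lborel"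
    using Ppair by (rule lborel_pair.measurable_emeasure_Pair2)
  then have meas: "?g \<in> borel_measurable borel"
    by simp
  have "emeasure lborel ?P = (\<integral>\<^sup>+z. emeasure lborel (?slice z) \<partial>lborel)"
    using lborel_pair.emeasure_pair_measure_alt2[OF Ppair] by (simp only: lborel_prod)
  also have "\<dots> = (\<integral>\<^sup>+z. ennreal (?g z) \<partial>lborel)"
  proof (rule nn_integral_cong)
    fix z
    show "emeasure lborel (?slice z) = ennreal (?g z)"
      using slice[of z] slice_empty[of z] by (cases "z \<in> {0..1}") simp_all
  qed
  finally have "(\<integral>\<^sup>+z. ennreal (?g z) \<partial>lborel) = ennreal (measure lebesgue ?P)"
    using emeasure_eq_measure2[OF lmeasurable_compact[OF P]] Pborel by simp
  then have "(?g has_integral measure lebesgue ?P) UNIV"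
    by (intro nn_integral_has_integral meas) auto
  then have "(G has_integral measure lebesgue ?P) {0..1}"
    unfolding g by (simp only: has_integral_restrict_UNIV)
  moreover have "((\<lambda>z. z ^ (?d + 1) * integral ?J (\<lambda>u. mu_hom f v u 1))
      has_integral 1 / Suc (?d + 1) * integral ?J (\<lambda>u. mu_hom f v u 1)) {0..1}"
    by (intro has_integral_mult_left has_integral_power_unit)
  \<comment> \<open>Integrability of the \<open>f\<close> term in \<open>z\<close> comes from here:
    it is the difference of the \<open>mu_hom\<close> term and \<open>G\<close>, whose integrals are
    both known.\<close>
  ultimately have "((\<lambda>z. z ^ (?d + 1) * integral ?J (\<lambda>u. mu_hom f v u 1) - G z) has_integral
      1 / Suc (?d + 1) * integral ?J (\<lambda>u. mu_hom f v u 1) - measure lebesgue ?P) {0..1}"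
    by (intro has_integral_diff)
  then have "((\<lambda>z. z ^ ?d * integral ?J (\<lambda>u. f (z *\<^sub>R u))) has_integral
      1 / Suc (?d + 1) * integral ?J (\<lambda>u. mu_hom f v u 1) - measure lebesgue ?P) {0..1}"
    by (rule has_integral_eq[rotated]) (simp add: G)
  then have "measure lebesgue ?P = 1 / Suc (?d + 1) * integral ?J (\<lambda>u. mu_hom f v u 1)
      - integral {0..1} (\<lambda>z. z ^ ?d * integral ?J (\<lambda>u. f (z *\<^sub>R u)))"
    by (simp add: integral_unique)
  \<comment> \<open>The factor \<open>1 / (d + 2)\<close> from integrating over \<open>z\<close>
    completes the \<open>1 / (d + 1)!\<close> of \<open>integral_mu_hom\<close> to
    \<open>1 / (d + 2)!\<close>.\<close>
  also have "1 / Suc (?d + 1) * integral ?J (\<lambda>u. mu_hom f v u 1)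
      = 1 / fact (?d + 2) * \<bar>det (vert_mat v)\<bar> * (\<Sum>j\<in>UNIV. f (v j))"
    by (simp add: integral_mu_hom[OF inj inv] det_vert_mat)
  finally show ?thesis
    using Pborel by simp
qed

end
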